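(* For every $\epsilon\in(0,\tfrac14)$ and every parameter $x$ with $1\le x\le \tfrac12\sqrt{1/\epsilon}$, there exists an undirected planar graph $G=(V,E,\mathbf{w})$ with positive edge weights such that $\mathbf{w}(G_{\mathrm{gr}(x)})\ge \Omega\!\left(\frac{\epsilon^{-1}}{x^2}\right)\cdot \mathbf{w}(G_{\mathsf{opt},\epsilon})$, where $G_{\mathrm{gr}(x)}$ is the greedy $(1+x\epsilon)$-spanner of $G$ and $G_{\mathsf{opt},\epsilon}$ is a minimum-weight $(1+\epsilon)$-spanner of $G$.
   Context: For an edge-weighted undirected graph $G=(V,E,\mathbf{w})$ and $t\ge1$, a $t$-spanner is a subgraph $H$ of $G$ on vertex set $V$ with $\mathsf{dist}_H(u,v)\le t\cdot\mathsf{dist}_G(u,v)$ for all $u,v\in V$. The greedy $t$-spanner is constructed as follows: start with $H=(V,\emptyset)$; consider the edges $(u,v)\in E$ in nondecreasing order of weight (ties broken arbitrarily), and add $(u,v)$ to $H$ if currently $\mathsf{dist}_H(u,v)>t\cdot \mathsf{dist}_G(u,v)$. The weight of a subgraph is the sum of its edge weights. The constant in $\Omega(\cdot)$ is absolute. *)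

theory Defs
  imports "HOL-Analysis.Analysis"
begin

text \<open>An undirected graph is a finite vertex set \<open>V\<close> together with a set \<open>E\<close> of two-element subsets
  of \<open>V\<close>; a subgraph with vertex set \<open>V\<close> is given by a subset of \<open>E\<close>.\<close>

definition weighted_graph :: "'a set \<Rightarrow> 'a set set \<Rightarrow> ('a set \<Rightarrow> real) \<Rightarrow> bool" where
  "weighted_graph V E w \<longleftrightarrow>
     finite V \<and> (\<forall>e\<in>E. e \<subseteq> V \<and> card e = 2) \<and> (\<forall>e\<in>E. 0 < w e)"

definition weight :: "('a set \<Rightarrow> real) \<Rightarrow> 'a set set \<Rightarrow> real" where
  "weight w F = (\<Sum>e\<in>F. w e)"

definition is_walk :: "'a set set \<Rightarrow> 'a \<Rightarrow> 'a list \<Rightarrow> 'a \<Rightarrow> bool" where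
  "is_walk F u p v \<longleftrightarrow>
     p \<noteq> [] \<and> hd p = u \<and> last p = v \<and> (\<forall>i. Suc i < length p \<longrightarrow> {p ! i, p ! Suc i} \<in> F)"

definition walk_weight :: "('a set \<Rightarrow> real) \<Rightarrow> 'a list \<Rightarrow> real" where
  "walk_weight w p = (\<Sum>i<length p - 1. w {p ! i, p ! Suc i})"

text \<open>The infimum of the empty set is \<open>\<infinity>\<close>, the distance between disconnected vertices.\<close>

definition graph_dist :: "('a set \<Rightarrow> real) \<Rightarrow> 'a set set \<Rightarrow> 'a \<Rightarrow> 'a \<Rightarrow> ereal" where
  "graph_dist w F u v = (INF p\<in>{p. is_walk F u p v}. ereal (walk_weight w p))"

definition is_spanner ::
    "real \<Rightarrow> 'a set \<Rightarrow> 'a set set \<Rightarrow> ('a set \<Rightarrow> real) \<Rightarrow> 'a set set \<Rightarrow> bool" where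
  "is_spanner t V E w F \<longleftrightarrow>
     F \<subseteq> E \<and> (\<forall>u\<in>V. \<forall>v\<in>V. graph_dist w F u v \<le> ereal t * graph_dist w E u v)"

definition is_min_weight_spanner ::
    "real \<Rightarrow> 'a set \<Rightarrow> 'a set set \<Rightarrow> ('a set \<Rightarrow> real) \<Rightarrow> 'a set set \<Rightarrow> bool" where
  "is_min_weight_spanner t V E w F \<longleftrightarrow>
     is_spanner t V E w F \<and> (\<forall>F'. is_spanner t V E w F' \<longrightarrow> weight w F \<le> weight w F')"

definition greedy_step ::
    "real \<Rightarrow> 'a set set \<Rightarrow> ('a set \<Rightarrow> real) \<Rightarrow> 'a set \<Rightarrow> 'a set set \<Rightarrow> 'a set set" where
  "greedy_step t E w e F =
     (if \<exists>u v. e = {u, v} \<and> graph_dist w F u v > ereal t * graph_dist w E u v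
      then insert e F else F)"

text \<open>Since ties are broken arbitrarily, a graph has one greedy spanner for each
  enumeration \<open>es\<close> of its edges in nondecreasing order of weight.\<close>

definition is_greedy_spanner ::
    "real \<Rightarrow> 'a set set \<Rightarrow> ('a set \<Rightarrow> real) \<Rightarrow> 'a set set \<Rightarrow> bool" where
  "is_greedy_spanner t E w F \<longleftrightarrow>
     (\<exists>es. distinct es \<and> set es = E \<and> sorted (map w es) \<and> F = fold (greedy_step t E w) es {})"

text \<open>Vertices are drawn as distinct points and edges as simple arcs between their endpoints;
  an arc contains no other vertex, and two arcs meet only at common endpoints.\<close>

definition planar :: "'a set \<Rightarrow> 'a set set \<Rightarrow> bool" where
  "planar V E \<longleftrightarrow>
     (\<exists>(pt :: 'a \<Rightarrow> real^2) (\<gamma> :: 'a set \<Rightarrow> real \<Rightarrow> real^2).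
        inj_on pt V \<and>
        (\<forall>e\<in>E. arc (\<gamma> e) \<and> {pathstart (\<gamma> e), pathfinish (\<gamma> e)} = pt ` e) \<and>
        (\<forall>e\<in>E. path_image (\<gamma> e) \<inter> pt ` V = pt ` e) \<and>
        (\<forall>e\<in>E. \<forall>f\<in>E. e \<noteq> f \<longrightarrow> path_image (\<gamma> e) \<inter> path_image (\<gamma> f) = pt ` (e \<inter> f)))"

text \<open>Greedy and minimum-weight spanners exist, so quantifying universally over them is not vacuous.\<close>

lemma weighted_graph_finite_edges:
  assumes "weighted_graph V E w"
  shows "finite E"
proof -
  have "E \<subseteq> Pow V" using assms by (auto simp: weighted_graph_def)
  then show ?thesis using assms by (meson finite_Pow_iff finite_subset weighted_graph_def)
qed

lemma greedy_spanner_exists: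
  assumes "weighted_graph V E w"
  shows "\<exists>F. is_greedy_spanner t E w F"
proof -
  obtain es where es: "set es = E" "distinct es"
    using finite_distinct_list[OF weighted_graph_finite_edges[OF assms]] by blast
  then have "distinct (sort_key w es)" "set (sort_key w es) = E" "sorted (map w (sort_key w es))"
    by simp_all
  then show ?thesis unfolding is_greedy_spanner_def by blast
qed

lemma min_weight_spanner_exists:
  assumes "weighted_graph V E w" "1 \<le> t"
  shows "\<exists>F. is_min_weight_spanner t V E w F"
proof -
  have "0 \<le> graph_dist w E u v" for u v
    unfolding graph_dist_def
  proof (rule INF_greatest)
    fix p assume "p \<in> {p. is_walk E u p v}"
    then have "{p ! i, p ! Suc i} \<in> E" if "i < length p - 1" for i
      using that by (auto simp: is_walk_def)
    then show "0 \<le> ereal (walk_weight w p)"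
      using assms(1) by (auto simp: walk_weight_def weighted_graph_def less_imp_le intro!: sum_nonneg)
  qed
  then have "graph_dist w E u v \<le> ereal t * graph_dist w E u v" for u v
    using ereal_mult_right_mono[of 1 "ereal t" "graph_dist w E u v"] assms(2)
    by (simp add: one_ereal_def)
  then have "is_spanner t V E w E" by (simp add: is_spanner_def)
  moreover have "finite {F. is_spanner t V E w F}"
    by (rule finite_subset[of _ "Pow E"])
       (auto simp: is_spanner_def weighted_graph_finite_edges[OF assms(1)])
  ultimately obtain F where "is_spanner t V E w F"
      "\<forall>F'. is_spanner t V E w F' \<longrightarrow> weight w F \<le> weight w F'"
    using ex_min_if_finite[of "weight w ` {F. is_spanner t V E w F}"]
    by (auto simp: not_less)
  then show ?thesis by (auto simp: is_min_weight_spanner_def)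
qed

end

theory Submission
  imports Defs
begin

text \<open>Two hubs \<open>a\<close> and \<open>b\<close> are joined by an edge of length \<open>1 - x\<epsilon>\<close> and by a detour of two edges whose
  total length is exactly \<open>1 + x\<epsilon>\<close> times larger.  Moreover there are about \<open>1/(x\<epsilon>)\<close> satellites,
  each at distance \<open>(x + 1)\<epsilon>\<close> from \<open>b\<close> and joined to \<open>a\<close> by an edge of length \<open>1\<close>.  The edges of length
  \<open>1\<close> can be replaced by walks through the edge \<open>ab\<close> of length \<open>1 + \<epsilon>\<close>, so there is a \<open>(1 + \<epsilon>)\<close>-spanner
  of weight \<open>O(1)\<close>.  The greedy algorithm, however, rejects \<open>ab\<close> in favour of the detour, after which the
  walk from \<open>a\<close> to a satellite through \<open>b\<close> has length
  \<open>(1 + x\<epsilon>)(1 - x\<epsilon>) + (x + 1)\<epsilon> > 1 + x\<epsilon>\<close>, because \<open>x\<^sup>2\<epsilon> < 1\<close>.  Hence it has to keep all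
  the edges of length \<open>1\<close>.\<close>

section \<open>Walks and distances\<close>

lemma is_walk_singleton [simp]: "is_walk F u [x] v \<longleftrightarrow> x = u \<and> x = v"
  by (auto simp: is_walk_def)

lemma is_walk_Nil [simp]: "\<not> is_walk F u [] v"
  by (simp add: is_walk_def)

lemma is_walk_Cons_Cons [simp]:
  "is_walk F u (x # y # p) v \<longleftrightarrow> x = u \<and> {x, y} \<in> F \<and> is_walk F y (y # p) v"
proof -
  have "(\<forall>i. Q i) \<longleftrightarrow> Q 0 \<and> (\<forall>i. Q (Suc i))" for Q :: "nat \<Rightarrow> bool"
    by (metis not0_implies_Suc)
  from this[of "\<lambda>i. Suc i < length (x # y # p) \<longrightarrow> {(x # y # p) ! i, (x # y # p) ! Suc i} \<in> F"]
  show ?thesis by (auto simp: is_walk_def)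
qed

lemma walk_weight_singleton [simp]: "walk_weight w [x] = 0"
  by (simp add: walk_weight_def)

lemma walk_weight_Cons_Cons [simp]:
  "walk_weight w (x # y # p) = w {x, y} + walk_weight w (y # p)"
  by (simp add: walk_weight_def sum.lessThan_Suc_shift del: sum.lessThan_Suc)

lemma walk_append:
  assumes "is_walk F u p y" "is_walk F y q v"
  shows "\<exists>r. is_walk F u r v \<and> walk_weight w r = walk_weight w p + walk_weight w q"
  using assms(1)
proof (induction p arbitrary: u rule: induct_list012)
  case (2 x)
  then show ?case using assms(2) by auto
next
  case (3 x z p)
  then obtain r where r: "is_walk F z r v"
    "walk_weight w r = walk_weight w (z # p) + walk_weight w q" by auto
  then obtain r' where "r = z # r'" by (cases r) (auto simp: is_walk_def)
  then show ?case using r 3 by (intro exI[of _ "x # r"]) auto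
qed simp

lemma graph_dist_le: "is_walk F u p v \<Longrightarrow> graph_dist w F u v \<le> ereal (walk_weight w p)"
  by (auto simp: graph_dist_def intro: INF_lower)

lemma graph_dist_antimono: "F \<subseteq> F' \<Longrightarrow> graph_dist w F' u v \<le> graph_dist w F u v"
  unfolding graph_dist_def by (rule INF_superset_mono) (auto simp: is_walk_def)

text \<open>The differences of \<open>\<phi>\<close> telescope along a walk, and without any walk
  the distance is infinite. A potential thus certifies a lower bound on a distance and replaces an
  enumeration of walks.\<close>

lemma graph_dist_ge_potential:
  fixes \<phi> :: "'a \<Rightarrow> real"
  assumes "\<And>p q. {p, q} \<in> F \<Longrightarrow> \<phi> q - \<phi> p \<le> w {p, q}"
  shows "ereal (\<phi> v - \<phi> u) \<le> graph_dist w F u v"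
proof -
  have "\<phi> v - \<phi> u \<le> walk_weight w p" if "is_walk F u p v" for p
    using that
  proof (induction p arbitrary: u rule: induct_list012)
    case (3 x y p)
    then have "\<phi> v - \<phi> y \<le> walk_weight w (y # p)" "\<phi> y - \<phi> x \<le> w {x, y}" "x = u"
      using assms by auto
    then show ?case by simp
  qed auto
  then show ?thesis by (auto simp: graph_dist_def intro: INF_greatest)
qed

text \<open>Replacing every edge of a walk by its substitute and concatenating stretches the whole
  walk by a factor of at most \<open>t\<close>.\<close>

lemma is_spannerI:
  assumes "F \<subseteq> E" "0 < t"
    and edge: "\<And>u v. {u, v} \<in> E \<Longrightarrow> \<exists>q. is_walk F u q v \<and> walk_weight w q \<le> t * w {u, v}"
  shows "is_spanner t V E w F"
proof -
  have *: "\<exists>q. is_walk F u q v \<and> walk_weight w q \<le> t * walk_weight w p"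
    if "is_walk E u p v" for u v p
    using that
  proof (induction p arbitrary: u rule: induct_list012)
    case (2 x)
    then show ?case by (intro exI[of _ "[x]"]) auto
  next
    case (3 x y p)
    then obtain q where q: "is_walk F y q v" "walk_weight w q \<le> t * walk_weight w (y # p)"
      by auto
    obtain q' where q': "is_walk F u q' y" "walk_weight w q' \<le> t * w {x, y}"
      using edge[of x y] 3 by auto
    from walk_append[OF q'(1) q(1), of w] q(2) q'(2) show ?case
      by (auto simp: distrib_left)
  qed simp
  \<comment> \<open>Dividing by \<open>t\<close> leaves the infimum alone on the right, where it can
    be treated walk by walk.\<close>
  have "graph_dist w F u v / ereal t \<le> graph_dist w E u v" for u v
    unfolding graph_dist_def[of w E]
  proof (rule INF_greatest)
    fix p assume "p \<in> {p. is_walk E u p v}"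
    then obtain q where "is_walk F u q v" "walk_weight w q \<le> t * walk_weight w p"
      using * by blast
    then have "graph_dist w F u v \<le> ereal t * ereal (walk_weight w p)"
      using graph_dist_le[of F u q v w] order_trans by fastforce
    then show "graph_dist w F u v / ereal t \<le> ereal (walk_weight w p)"
      using assms(2) by (subst ereal_divide_le_pos) auto
  qed
  then show ?thesis
    using assms(1,2) by (auto simp: is_spanner_def ereal_divide_le_pos)
qed

section \<open>The greedy spanner\<close>

lemma fold_greedy_step_mono: "F \<subseteq> fold (greedy_step t E w) es F"
  by (induction es arbitrary: F) (auto simp: greedy_step_def subset_iff)

lemma fold_greedy_step_subset: "fold (greedy_step t E w) es F \<subseteq> F \<union> set es"
proof (induction es arbitrary: F)
  case (Cons e es)
  show ?case using Cons[of "greedy_step t E w e F"] by (auto simp: greedy_step_def split: if_splits)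
qed simp

lemma greedy_spanner_subset: "is_greedy_spanner t E w F \<Longrightarrow> F \<subseteq> E"
  unfolding is_greedy_spanner_def using fold_greedy_step_subset[of t E w _ "{}"] by auto

text \<open>\<open>F'\<close> is the partial spanner at the moment when \<open>e\<close> is
  examined. It already contains every strictly lighter edge that is ever accepted, however ties are
  broken, and the fate of \<open>e\<close> is settled there because \<open>e\<close> is examined
  only once.\<close>

lemma greedy_spanner_edge_cases:
  assumes "is_greedy_spanner t E w F" "e \<in> E"
  obtains F' where "F' \<subseteq> F - {e}" "\<And>f. f \<in> F \<Longrightarrow> w f < w e \<Longrightarrow> f \<in> F'"
    "e \<in> F \<longleftrightarrow> (\<exists>u v. e = {u, v} \<and> graph_dist w F' u v > ereal t * graph_dist w E u v)"
proof -
  let ?g = "fold (greedy_step t E w)"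
  obtain es where es: "distinct es" "set es = E" "sorted (map w es)" "F = ?g es {}"
    using assms(1) by (auto simp: is_greedy_spanner_def)
  obtain pre post where split: "es = pre @ e # post"
    using assms(2) es(2) split_list by metis
  define F' where "F' = ?g pre {}"
  define F'' where "F'' = greedy_step t E w e F'"
  have F: "F = ?g post F''" using es(4) split by (simp add: F'_def F''_def)
  have pre: "F' \<subseteq> set pre" using fold_greedy_step_subset[of t E w pre "{}"] by (simp add: F'_def)
  have "F' \<subseteq> F''" by (auto simp: F''_def greedy_step_def)
  then have sub: "F' \<subseteq> F" using fold_greedy_step_mono[of F'' t E w post] F by blast
  have notin: "e \<notin> set pre" "e \<notin> set post" using es(1) split by auto
  have iff: "e \<in> F \<longleftrightarrow> e \<in> F''"
    using fold_greedy_step_mono[of F'' t E w post] fold_greedy_step_subset[of t E w post F''] F notin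
    by blast
  have "f \<in> F'" if f: "f \<in> F" "w f < w e" for f
  proof -
    have "f \<notin> set post" using es(3) split f(2) by (auto simp: sorted_append)
    then have "f \<in> F''" using fold_greedy_step_subset[of t E w post F''] F f(1) by blast
    then show ?thesis using f(2) by (auto simp: F''_def greedy_step_def split: if_splits)
  qed
  moreover have "F' \<subseteq> F - {e}" using sub pre notin by blast
  moreover have "e \<in> F'' \<longleftrightarrow>
      (\<exists>u v. e = {u, v} \<and> graph_dist w F' u v > ereal t * graph_dist w E u v)"
    using pre notin by (auto simp: F''_def greedy_step_def)
  ultimately show thesis using that iff by blast
qed

text \<open>A criterion independent of the processing order: when the edge is examined, only a part
  of \<open>F - {{u, v}}\<close> is present, so distances are then at least those in
  \<open>F - {{u, v}}\<close>.\<close>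

lemma greedy_spanner_keeps:
  assumes "is_greedy_spanner t E w F" "{u, v} \<in> E" "0 \<le> t"
    and "ereal (t * w {u, v}) < graph_dist w (F - {{u, v}}) u v"
  shows "{u, v} \<in> F"
proof -
  obtain F' where F': "F' \<subseteq> F - {{u, v}}"
    "{u, v} \<in> F \<longleftrightarrow>
      (\<exists>u' v'. {u, v} = {u', v'} \<and> graph_dist w F' u' v' > ereal t * graph_dist w E u' v')"
    using greedy_spanner_edge_cases[OF assms(1,2)] by metis
  have "graph_dist w E u v \<le> ereal (w {u, v})"
    using graph_dist_le[of E u "[u, v]" v w] assms(2) by simp
  then have "ereal t * graph_dist w E u v \<le> ereal (t * w {u, v})"
    using ereal_mult_left_mono[of "graph_dist w E u v" "ereal (w {u, v})" "ereal t"] assms(3) by simp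
  also have "\<dots> < graph_dist w (F - {{u, v}}) u v" by fact
  also have "\<dots> \<le> graph_dist w F' u v" using F'(1) by (rule graph_dist_antimono)
  finally show ?thesis using F'(2) by blast
qed

section \<open>The theta graph\<close>

text \<open>The hubs are \<open>0\<close> and \<open>1\<close>, the detour runs through \<open>2\<close>, and the satellites are the vertices
  from \<open>3\<close> on.\<close>

definition theta_edges :: "nat \<Rightarrow> nat set set" where
  "theta_edges n = insert {0, 1} ((\<lambda>v. {0, v}) ` {2..<n} \<union> (\<lambda>v. {1, v}) ` {2..<n})"

text \<open>Hub \<open>0\<close> plays the role of \<open>a\<close> and hub \<open>1\<close> that of
  \<open>b\<close>; \<open>g\<close> is half of the detour and \<open>s\<close> the length of the
  edge from a satellite to \<open>b\<close>.\<close>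

definition theta_weight :: "real \<Rightarrow> real \<Rightarrow> real \<Rightarrow> nat set \<Rightarrow> real" where
  "theta_weight h g s e =
     (if e = {0, 1} then h else if 2 \<in> e then g else if 0 \<in> e then 1 else s)"

lemma theta_weight_simps [simp]:
  "theta_weight h g s {0, Suc 0} = h" "theta_weight h g s {Suc 0, 0} = h"
  "theta_weight h g s {0, 2} = g" "theta_weight h g s {Suc 0, 2} = g"
  "theta_weight h g s {2, 0} = g" "theta_weight h g s {2, Suc 0} = g"
  "3 \<le> i \<Longrightarrow> theta_weight h g s {0, i} = 1" "3 \<le> i \<Longrightarrow> theta_weight h g s {i, 0} = 1"
  "3 \<le> i \<Longrightarrow> theta_weight h g s {Suc 0, i} = s" "3 \<le> i \<Longrightarrow> theta_weight h g s {i, Suc 0} = s"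
  by (auto simp: theta_weight_def doubleton_eq_iff)

lemma doubleton_in_theta_edges:
  "{p, q} \<in> theta_edges n \<longleftrightarrow>
     p = 0 \<and> q = 1 \<or> p = 1 \<and> q = 0 \<or>
     p \<in> {0, 1} \<and> q \<in> {2..<n} \<or> q \<in> {0, 1} \<and> p \<in> {2..<n}"
  by (auto simp: theta_edges_def doubleton_eq_iff image_iff)

lemma theta_edge_cases:
  assumes "e \<in> theta_edges n"
  obtains (hub) "e = {0, 1}" | (upper) v where "e = {0, v}" "v \<in> {2..<n}"
    | (lower) v where "e = {1, v}" "v \<in> {2..<n}"
  using assms by (auto simp: theta_edges_def)

lemma weighted_graph_theta:
  assumes "0 < h" "0 < g" "0 < s"
  shows "weighted_graph {..<n + 3} (theta_edges (n + 3)) (theta_weight h g s)"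
  using assms by (auto simp: weighted_graph_def theta_edges_def theta_weight_def)

section \<open>A straight-line drawing of the theta graph\<close>

definition theta_pt :: "nat \<Rightarrow> real^2" where
  "theta_pt v = (if v = 0 then vector [0, 1] else if v = 1 then vector [0, - 1] else vector [real v, 0])"

lemma theta_pt_simps:
  "theta_pt 0 $ 1 = 0" "theta_pt 0 $ 2 = 1"
  "theta_pt (Suc 0) $ 1 = 0" "theta_pt (Suc 0) $ 2 = - 1"
  "2 \<le> v \<Longrightarrow> theta_pt v $ 1 = real v" "2 \<le> v \<Longrightarrow> theta_pt v $ 2 = 0"
  by (auto simp: theta_pt_def)

lemma vec2_eq_iff: "x = y \<longleftrightarrow> x $ 1 = y $ 1 \<and> x $ 2 = y $ 2" for x y :: "'a^2"
  by (simp add: vec_eq_iff forall_2)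

lemma inj_theta_pt: "inj theta_pt"
proof (rule injI)
  fix u v assume "theta_pt u = theta_pt v"
  then show "u = v"
    by (auto simp: theta_pt_def vec2_eq_iff split: if_splits)
qed

text \<open>The height of a point determines its position on the segment. Eliminating the parameter
  in this way, here and for the other edges, turns crossings into equations in the
  coordinates.\<close>

lemma segment_hub:
  "closed_segment (theta_pt 0) (theta_pt 1) = {z. z $ 1 = 0 \<and> -1 \<le> z $ 2 \<and> z $ 2 \<le> 1}"
proof (intro set_eqI iffI)
  fix z :: "real^2" assume "z \<in> {z. z $ 1 = 0 \<and> -1 \<le> z $ 2 \<and> z $ 2 \<le> 1}"
  then show "z \<in> closed_segment (theta_pt 0) (theta_pt 1)"
    by (auto simp: in_segment vec2_eq_iff theta_pt_simps field_simps
        intro!: exI[of _ "(1 - z $ 2) / 2"])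
qed (auto simp: in_segment theta_pt_simps)

lemma segment_upper:
  assumes "2 \<le> v"
  shows "closed_segment (theta_pt 0) (theta_pt v) =
    {z. z $ 1 = real v * (1 - z $ 2) \<and> 0 \<le> z $ 2 \<and> z $ 2 \<le> 1}"
proof (intro set_eqI iffI)
  fix z :: "real^2" assume "z \<in> {z. z $ 1 = real v * (1 - z $ 2) \<and> 0 \<le> z $ 2 \<and> z $ 2 \<le> 1}"
  then show "z \<in> closed_segment (theta_pt 0) (theta_pt v)"
    using assms by (auto simp: in_segment vec2_eq_iff theta_pt_simps intro!: exI[of _ "1 - z $ 2"])
qed (use assms in \<open>auto simp: in_segment theta_pt_simps\<close>)

lemma segment_lower:
  assumes "2 \<le> v"
  shows "closed_segment (theta_pt 1) (theta_pt v) =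
    {z. z $ 1 = real v * (1 + z $ 2) \<and> -1 \<le> z $ 2 \<and> z $ 2 \<le> 0}"
proof (intro set_eqI iffI)
  fix z :: "real^2" assume "z \<in> {z. z $ 1 = real v * (1 + z $ 2) \<and> -1 \<le> z $ 2 \<and> z $ 2 \<le> 0}"
  then show "z \<in> closed_segment (theta_pt 1) (theta_pt v)"
    using assms by (auto simp: in_segment vec2_eq_iff theta_pt_simps intro!: exI[of _ "1 + z $ 2"])
qed (use assms in \<open>auto simp: in_segment theta_pt_simps\<close>)

text \<open>The hubs lie above and below the horizontal axis that carries all other vertices. Edges
  to that axis stay in the half-plane of their hub, edges at a common hub have different directions,
  and the hub edge stays on the vertical axis.\<close>

lemma planar_theta:
  assumes "2 \<le> n"
  shows "planar {..<n} (theta_edges n)"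
proof -
  let ?P = theta_pt
  \<comment> \<open>\<open>Min\<close> and \<open>Max\<close> orient the unordered edge; as the hubs
    carry the smallest numbers, each path starts at a hub.\<close>
  define \<gamma> where "\<gamma> e = linepath (?P (Min e)) (?P (Max e))" for e
  have hub: "path_image (\<gamma> {0, 1}) = {z. z $ 1 = 0 \<and> -1 \<le> z $ 2 \<and> z $ 2 \<le> 1}"
    using segment_hub by (simp add: \<gamma>_def)
  have upper: "path_image (\<gamma> {0, v}) =
      {z. z $ 1 = real v * (1 - z $ 2) \<and> 0 \<le> z $ 2 \<and> z $ 2 \<le> 1}"
    and lower: "path_image (\<gamma> {1, v}) =
      {z. z $ 1 = real v * (1 + z $ 2) \<and> -1 \<le> z $ 2 \<and> z $ 2 \<le> 0}"
    if "v \<in> {2..<n}" for v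
    using segment_upper[of v] segment_lower[of v] that by (simp_all add: \<gamma>_def max_def min_def)
  have ends: "arc (\<gamma> e) \<and> {pathstart (\<gamma> e), pathfinish (\<gamma> e)} = ?P ` e"
    if "e \<in> theta_edges n" for e
    using that
    by (cases rule: theta_edge_cases) (auto simp: \<gamma>_def inj_eq[OF inj_theta_pt] max_def min_def intro!: arc_linepath)
  have vertex: "?P v \<in> path_image (\<gamma> e) \<longleftrightarrow> v \<in> e" if "e \<in> theta_edges n" for e v
  proof -
    consider "v = 0" | "v = 1" | "2 \<le> v" by linarith
    note v = this
    from that show ?thesis
    proof (cases rule: theta_edge_cases)
      case hub
      show ?thesis unfolding hub(1) \<open>path_image (\<gamma> {0, 1}) = _\<close>
        by (cases rule: v) (auto simp: theta_pt_simps)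
    next
      case (upper u)
      then show ?thesis using \<open>u \<in> {2..<n} \<Longrightarrow> path_image (\<gamma> {0, u}) = _\<close>
        by (cases rule: v) (auto simp: theta_pt_simps)
    next
      case (lower u)
      then show ?thesis using \<open>u \<in> {2..<n} \<Longrightarrow> path_image (\<gamma> {1, u}) = _\<close>
        by (cases rule: v) (auto simp: theta_pt_simps)
    qed
  qed
  have uu: "z = ?P 0" if "z \<in> path_image (\<gamma> {0, u})" "z \<in> path_image (\<gamma> {0, v})"
    "u \<noteq> v" "u \<in> {2..<n}" "v \<in> {2..<n}" for z u v
    using that by (auto simp: upper vec2_eq_iff theta_pt_simps)
  have ll: "z = ?P 1" if "z \<in> path_image (\<gamma> {1, u})" "z \<in> path_image (\<gamma> {1, v})"
    "u \<noteq> v" "u \<in> {2..<n}" "v \<in> {2..<n}" for z u v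
    using that by (auto simp: lower[simplified] vec2_eq_iff theta_pt_simps)
  have ul: "u = v \<and> z = ?P v" if "z \<in> path_image (\<gamma> {0, u})" "z \<in> path_image (\<gamma> {1, v})"
    "u \<in> {2..<n}" "v \<in> {2..<n}" for z u v
  proof -
    \<comment> \<open>The two half-planes share only the horizontal axis, where the abscissa of
      \<open>z\<close> is both \<open>u\<close> and \<open>v\<close>.\<close>
    have "z $ 2 = 0" using that by (auto simp: upper lower[simplified])
    then show ?thesis using that by (auto simp: upper lower[simplified] vec2_eq_iff theta_pt_simps)
  qed
  have hu: "z = ?P 0" if "z \<in> path_image (\<gamma> {0, 1})" "z \<in> path_image (\<gamma> {0, v})"
    "v \<in> {2..<n}" for z v
    using that by (auto simp: hub[simplified] upper vec2_eq_iff theta_pt_simps)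
  have hl: "z = ?P 1" if "z \<in> path_image (\<gamma> {0, 1})" "z \<in> path_image (\<gamma> {1, v})"
    "v \<in> {2..<n}" for z v
    using that by (auto simp: hub[simplified] lower[simplified] vec2_eq_iff theta_pt_simps)
  have "path_image (\<gamma> e) \<inter> path_image (\<gamma> f) \<subseteq> ?P ` (e \<inter> f)"
    if e: "e \<in> theta_edges n" and f: "f \<in> theta_edges n" and "e \<noteq> f" for e f
  proof
    fix z assume "z \<in> path_image (\<gamma> e) \<inter> path_image (\<gamma> f)"
    then have z: "z \<in> path_image (\<gamma> e)" "z \<in> path_image (\<gamma> f)" by auto
    from e show "z \<in> ?P ` (e \<inter> f)"
    proof (cases rule: theta_edge_cases)
      case e: hub
      from f show ?thesis
        by (cases rule: theta_edge_cases) (use z \<open>e \<noteq> f\<close> e in \<open>auto dest: hu[simplified] hl[simplified]\<close>)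
    next
      case e: (upper u)
      from f show ?thesis
      proof (cases rule: theta_edge_cases)
        case hub
        then show ?thesis using z e hu by auto
      next
        case (upper v)
        then show ?thesis using z e uu[of z u v] \<open>e \<noteq> f\<close> by auto
      next
        case (lower v)
        then show ?thesis using z e ul[of z u v] by auto
      qed
    next
      case e: (lower u)
      from f show ?thesis
      proof (cases rule: theta_edge_cases)
        case hub
        then show ?thesis using z e hl[of z u] by auto
      next
        case (upper v)
        then show ?thesis using z e ul[of z v u] by auto
      next
        case (lower v)
        then show ?thesis using z e ll[of z u v] \<open>e \<noteq> f\<close> by auto
      qed
    qed
  qed
  moreover have "?P ` (e \<inter> f) \<subseteq> path_image (\<gamma> e) \<inter> path_image (\<gamma> f)"
    if "e \<in> theta_edges n" "f \<in> theta_edges n" for e f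
    using vertex that by auto
  moreover have "path_image (\<gamma> e) \<inter> ?P ` {..<n} = ?P ` e" if "e \<in> theta_edges n" for e
  proof -
    have "e \<subseteq> {..<n}" using that assms by (auto simp: theta_edges_def)
    then show ?thesis using vertex[OF that] by auto
  qed
  ultimately show ?thesis
    unfolding planar_def using ends
    by (intro exI[of _ ?P] exI[of _ \<gamma>] conjI ballI impI inj_on_subset[OF inj_theta_pt])
      (simp_all add: subset_antisym)
qed

section \<open>Spanners of the theta graph\<close>

text \<open>The absolute values cover both orientations of an edge. The conditions are guarded by
  membership in \<open>F\<close>, so a deleted or rejected edge does not constrain the
  potential.\<close>

lemma theta_dist_ge:
  fixes \<phi> :: "nat \<Rightarrow> real"
  assumes "F \<subseteq> theta_edges n"
    and hub: "{0, 1} \<in> F \<Longrightarrow> \<bar>\<phi> 1 - \<phi> 0\<bar> \<le> h"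
    and "{0, 2} \<in> F \<Longrightarrow> \<bar>\<phi> 2 - \<phi> 0\<bar> \<le> g" "{1, 2} \<in> F \<Longrightarrow> \<bar>\<phi> 2 - \<phi> 1\<bar> \<le> g"
    and "\<And>i. 3 \<le> i \<Longrightarrow> {0, i} \<in> F \<Longrightarrow> \<bar>\<phi> i - \<phi> 0\<bar> \<le> 1"
    and "\<And>i. 3 \<le> i \<Longrightarrow> {1, i} \<in> F \<Longrightarrow> \<bar>\<phi> i - \<phi> 1\<bar> \<le> s"
  shows "ereal (\<phi> v - \<phi> u) \<le> graph_dist (theta_weight h g s) F u v"
proof (rule graph_dist_ge_potential)
  fix p q assume pq: "{p, q} \<in> F"
  have F: "\<bar>\<phi> j - \<phi> i\<bar> \<le> theta_weight h g s {i, j}" if "{i, j} \<in> F" "i \<in> {0, 1}" "j \<in> {2..<n}" for i j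
  proof -
    consider "j = 2" | "3 \<le> j" using \<open>j \<in> {2..<n}\<close> by fastforce
    then show ?thesis using that assms(3-6) by cases auto
  qed
  have "{p, q} \<in> theta_edges n" using pq assms(1) by blast
  then consider "p = 0 \<and> q = 1 \<or> p = 1 \<and> q = 0" | "p \<in> {0, 1} \<and> q \<in> {2..<n}" | "q \<in> {0, 1} \<and> p \<in> {2..<n}"
    unfolding doubleton_in_theta_edges by blast
  then show "\<phi> q - \<phi> p \<le> theta_weight h g s {p, q}"
  proof cases
    case 1
    then show ?thesis using pq hub by (auto simp: insert_commute abs_le_iff)
  next
    case 2
    then show ?thesis using pq F[of p q] by simp
  next
    case 3
    then show ?thesis using pq F[of q p] by (simp add: insert_commute)
  qed
qed

text \<open>The detour edges lack a good substitute and are kept. Being lighter than the hub edge,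
  they are present when it is examined, and together they are just short enough to reject it. Then
  every other route from hub \<open>0\<close> to satellite \<open>i\<close> has length at least
  \<open>2 * g + s\<close>.\<close>

lemma greedy_theta:
  assumes "0 < h" "0 < \<delta>" "\<delta> < 1" "h \<le> 1" and g: "2 * g = (1 + \<delta>) * h" and "2 * g \<le> 1" "0 \<le> s"
    and s: "1 + \<delta> < 2 * g + s"
    and greedy: "is_greedy_spanner (1 + \<delta>) (theta_edges n) (theta_weight h g s) F"
    and i: "i \<in> {3..<n}"
  shows "{0, i} \<in> F"
proof -
  let ?E = "theta_edges n" and ?w = "theta_weight h g s"
  have F: "F \<subseteq> ?E" using greedy by (rule greedy_spanner_subset)
  have "\<delta> * h < h" "0 < \<delta> * h" using assms by simp_all
  moreover have "2 * g = h + \<delta> * h" using g by (simp add: algebra_simps)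
  ultimately have gh: "0 < g" "g < h" "h < 2 * g" using \<open>0 < h\<close> by linarith+
  then have "\<delta> * g < h"
    using mult_strict_mono[of \<delta> 1 g h] \<open>0 < \<delta>\<close> \<open>\<delta> < 1\<close> by simp
  then have g_keep: "(1 + \<delta>) * g < h + g" by (simp add: algebra_simps)
  have 02: "{0, 2} \<in> F"
  proof (rule greedy_spanner_keeps[OF greedy])
    \<comment> \<open>A substitute costs at least \<open>h + g\<close>, the length of the way
      through hub \<open>1\<close>. The satellites share the potential of hub \<open>1\<close>,
      which \<open>h \<le> 1\<close> permits.\<close>
    let ?\<phi> = "\<lambda>v::nat. if v = 0 then 0 else if v = 2 then h + g else h"
    have "ereal (?\<phi> 2 - ?\<phi> 0) \<le> graph_dist ?w (F - {{0, 2}}) 0 2"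
      by (rule theta_dist_ge[of _ n]) (use F assms gh in auto)
    then show "ereal ((1 + \<delta>) * ?w {0, 2}) < graph_dist ?w (F - {{0, 2}}) 0 2"
      by (rule less_le_trans[rotated]) (use g_keep in simp)
  qed (use i \<open>0 < \<delta>\<close> in \<open>auto simp: doubleton_in_theta_edges\<close>)
  have 12: "{1, 2} \<in> F"
  proof (rule greedy_spanner_keeps[OF greedy])
    let ?\<phi> = "\<lambda>v::nat. if v = 2 then h + g else if v = 0 then h else 0"
    have "ereal (?\<phi> 2 - ?\<phi> 1) \<le> graph_dist ?w (F - {{1, 2}}) 1 2"
      by (rule theta_dist_ge[of _ n]) (use F assms gh in auto)
    then show "ereal ((1 + \<delta>) * ?w {1, 2}) < graph_dist ?w (F - {{1, 2}}) 1 2"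
      by (rule less_le_trans[rotated]) (use g_keep in simp)
  qed (use i \<open>0 < \<delta>\<close> in \<open>auto simp: doubleton_in_theta_edges\<close>)
  have 01: "{0, 1} \<notin> F"
  proof
    assume "{0, 1} \<in> F"
    moreover obtain F' where F': "\<And>f. f \<in> F \<Longrightarrow> ?w f < ?w {0, 1} \<Longrightarrow> f \<in> F'"
      "{0, 1} \<in> F \<longleftrightarrow> (\<exists>u v. {0, 1} = {u, v} \<and>
        graph_dist ?w F' u v > ereal (1 + \<delta>) * graph_dist ?w ?E u v)"
      using greedy_spanner_edge_cases[OF greedy, of "{0, 1}"]
      by (metis insertI1 theta_edges_def)
    ultimately obtain u v where uv: "{0, 1} = {u, v}"
      "graph_dist ?w F' u v > ereal (1 + \<delta>) * graph_dist ?w ?E u v" by auto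
    \<comment> \<open>The strict inequality \<open>g < h\<close> puts both halves of the detour
      before the hub edge in every admissible order.\<close>
    have "{0, 2} \<in> F'" "{1, 2} \<in> F'" using F'(1) 02 12 gh by simp_all
    then have "graph_dist ?w F' u v \<le> ereal (2 * g)"
      using uv(1) graph_dist_le[of F' 0 "[0, 2, 1]" 1 ?w] graph_dist_le[of F' 1 "[1, 2, 0]" 0 ?w]
      by (auto simp: doubleton_eq_iff insert_commute)
    also have "\<dots> = ereal (1 + \<delta>) * ereal h" using g by simp
    also have "ereal h \<le> graph_dist ?w ?E u v"
    proof -
      \<comment> \<open>The satellites take the potential of hub \<open>1\<close>, whether that is
        \<open>u\<close> or \<open>v\<close>; vertex \<open>2\<close> sits halfway, which
        \<open>h < 2 * g\<close> permits.\<close>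
      let ?\<phi> = "\<lambda>i. if i = u then 0 else if i = v then h else if i = 2 then h / 2 else if v = 1 then h else 0"
      have "ereal (?\<phi> v - ?\<phi> u) \<le> graph_dist ?w ?E u v"
        by (rule theta_dist_ge[of _ n]) (use uv(1) assms gh in \<open>auto simp: doubleton_eq_iff\<close>)
      then show ?thesis using uv(1) by (auto simp: doubleton_eq_iff)
    qed
    then have "ereal (1 + \<delta>) * ereal h \<le> ereal (1 + \<delta>) * graph_dist ?w ?E u v"
      using \<open>0 < \<delta>\<close> by (intro ereal_mult_left_mono) auto
    finally show False using uv(2) by simp
  qed
  show ?thesis
  proof (rule greedy_spanner_keeps[OF greedy])
    \<comment> \<open>With the hub edge rejected, hub \<open>1\<close> can be raised to
      \<open>2 * g\<close>. The other satellites share this value since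
      \<open>2 * g \<le> 1\<close>, and \<open>i\<close> lies \<open>s\<close> higher.\<close>
    let ?\<phi> = "\<lambda>v. if v = 0 then 0 else if v = 2 then g else if v = i then 2 * g + s else 2 * g"
    have "ereal (?\<phi> i - ?\<phi> 0) \<le> graph_dist ?w (F - {{0, i}}) 0 i"
      by (rule theta_dist_ge[of _ n]) (use F assms gh 01 in auto)
    then show "ereal ((1 + \<delta>) * ?w {0, i}) < graph_dist ?w (F - {{0, i}}) 0 i"
      by (rule less_le_trans[rotated]) (use i s in simp)
  qed (use i \<open>0 < \<delta>\<close> in \<open>auto simp: doubleton_in_theta_edges\<close>)
qed

text \<open>Each deleted edge \<open>{0, i}\<close> is replaced by the way through hub
  \<open>1\<close>, of length \<open>h + s\<close>.\<close>

lemma light_spanner_theta: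
  assumes "0 \<le> \<epsilon>" "0 < h" "0 < g" "0 < s" "h + s \<le> 1 + \<epsilon>"
  shows "is_spanner (1 + \<epsilon>) V (theta_edges n) (theta_weight h g s)
    (theta_edges n - (\<lambda>i. {0, i}) ` {3..<n})"
proof (rule is_spannerI)
  let ?E = "theta_edges n" and ?w = "theta_weight h g s"
  let ?F = "?E - (\<lambda>i. {0, i}) ` {3..<n}"
  fix u v assume uv: "{u, v} \<in> ?E"
  show "\<exists>q. is_walk ?F u q v \<and> walk_weight ?w q \<le> (1 + \<epsilon>) * ?w {u, v}"
  proof (cases "{u, v} \<in> ?F")
    case True
    have "0 \<le> \<epsilon> * ?w {u, v}" using assms by (simp add: theta_weight_def)
    then show ?thesis using True by (intro exI[of _ "[u, v]"]) (simp add: algebra_simps)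
  next
    case False
    then obtain i where i: "i \<in> {3..<n}" "{u, v} = {0, i}" using uv by auto
    have F: "{0, 1} \<in> ?F" "{1, 0} \<in> ?F" "{1, i} \<in> ?F" "{i, 1} \<in> ?F"
      using i(1) by (simp_all add: doubleton_in_theta_edges image_iff doubleton_eq_iff)
    from i(2) consider "u = 0" "v = i" | "u = i" "v = 0" by (auto simp: doubleton_eq_iff)
    then show ?thesis
    proof cases
      case 1
      then show ?thesis using F i assms by (intro exI[of _ "[0, 1, i]"]) auto
    next
      case 2
      then show ?thesis using F i assms by (intro exI[of _ "[i, 1, 0]"]) auto
    qed
  qed
qed (use assms(1) in auto)

text \<open>What remains is the triangle on \<open>0\<close>, \<open>1\<close>, \<open>2\<close> and
  one edge of length \<open>s\<close> per satellite.\<close>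

lemma weight_light_spanner_theta:
  "weight (theta_weight h g s) (theta_edges (n + 3) - (\<lambda>i. {0, i}) ` {3..<n + 3}) = h + 2 * g + n * s"
proof -
  let ?A = "{{0, 1}, {0, 2}, {1, 2 :: nat}}" and ?B = "(\<lambda>i. {1, i}) ` {3..<n + 3}"
  have "{2..<n + 3} = insert 2 {3..<n + 3}" by auto
  then have "theta_edges (n + 3) - (\<lambda>i. {0, i}) ` {3..<n + 3} = ?A \<union> ?B"
    by (auto simp: theta_edges_def doubleton_eq_iff)
  moreover have "?A \<inter> ?B = {}"
    by (simp add: disjoint_iff image_iff doubleton_eq_iff)
  then have "weight (theta_weight h g s) (?A \<union> ?B) =
      weight (theta_weight h g s) ?A + weight (theta_weight h g s) ?B"
    unfolding weight_def by (intro sum.union_disjoint) simp_all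
  moreover have "inj_on (\<lambda>i. {1, i}) {3..<n + 3}" by (auto simp: inj_on_def doubleton_eq_iff)
  then have "weight (theta_weight h g s) ?B = n * s"
    by (simp add: weight_def sum.reindex)
  moreover have "weight (theta_weight h g s) ?A = h + 2 * g"
    by (simp add: weight_def doubleton_eq_iff)
  ultimately show ?thesis by simp
qed

section \<open>Choice of the parameters and comparison of the two weights\<close>

theorem theorem6p1:
  shows "\<exists>c::real. c > 0 \<and>
    (\<forall>\<epsilon> x :: real. 0 < \<epsilon> \<and> \<epsilon> < 1/4 \<and> 1 \<le> x \<and> x \<le> 1/2 * sqrt (1/\<epsilon>) \<longrightarrow>
      (\<exists>(V :: nat set) (E :: nat set set) (w :: nat set \<Rightarrow> real).
         weighted_graph V E w \<and> planar V E \<and> E \<noteq> {} \<and>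
         (\<forall>G_gr G_opt.
            is_greedy_spanner (1 + x * \<epsilon>) E w G_gr \<and>
            is_min_weight_spanner (1 + \<epsilon>) V E w G_opt \<longrightarrow>
              weight w G_gr \<ge> c * ((1/\<epsilon>) / x^2) * weight w G_opt)))"
proof (intro exI[of _ "1/5"] conjI allI impI)
  fix \<epsilon> x :: real
  assume "0 < \<epsilon> \<and> \<epsilon> < 1/4 \<and> 1 \<le> x \<and> x \<le> 1/2 * sqrt (1/\<epsilon>)"
  then have \<epsilon>: "0 < \<epsilon>" "\<epsilon> < 1/4" and x: "1 \<le> x" "x \<le> 1/2 * sqrt (1/\<epsilon>)" by auto
  define \<delta> where "\<delta> = x * \<epsilon>"
  \<comment> \<open>The choices make \<open>h + s = 1 + \<epsilon>\<close> and
    \<open>2 * g = (1 + \<delta>) * h\<close> tight. Equality in the latter still rejects the hub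
    edge, since an insertion asks for a strict inequality.\<close>
  define h where "h = 1 - \<delta>"
  define g where "g = (1 + \<delta>) * h / 2"
  define s where "s = \<delta> + \<epsilon>"
  \<comment> \<open>With about \<open>1 / \<delta>\<close> satellites the edges of length
    \<open>s\<close> have bounded total weight, while those of length \<open>1\<close> weigh
    \<open>n\<close>.\<close>
  define n where "n = nat \<lceil>1 / \<delta>\<rceil>"
  \<comment> \<open>Squaring the upper bound on \<open>x\<close> leads to
    \<open>\<delta>\<^sup>2 \<le> \<epsilon> / 4\<close>, from which both
    \<open>\<delta> \<le> 1/4\<close> and the final gap for the greedy spanner follow.\<close>
  have "x\<^sup>2 \<le> (1/2 * sqrt (1/\<epsilon>))\<^sup>2" using x by (intro power_mono) auto
  then have "x\<^sup>2 \<le> 1 / (4 * \<epsilon>)" using \<epsilon> by (simp add: power_mult_distrib power_divide)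
  then have "x\<^sup>2 * \<epsilon> \<le> 1/4" using \<epsilon> by (simp add: field_simps)
  then have "x\<^sup>2 * \<epsilon> * \<epsilon> \<le> 1/4 * \<epsilon>" using \<epsilon> by (intro mult_right_mono) auto
  then have \<delta>\<epsilon>: "\<delta>\<^sup>2 \<le> \<epsilon> / 4" by (simp add: \<delta>_def power2_eq_square mult_ac)
  have \<delta>: "0 < \<delta>" "\<epsilon> \<le> \<delta>" using \<epsilon> x by (simp_all add: \<delta>_def)
  have "\<delta>\<^sup>2 \<le> (1/4)\<^sup>2" using \<delta>\<epsilon> \<epsilon> by (simp add: power2_eq_square)
  then have "\<delta> \<le> 1/4" by (rule power2_le_imp_le) simp
  have g2: "2 * g = 1 - \<delta>\<^sup>2" by (simp add: g_def h_def power2_eq_square field_simps)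
  have h: "0 < h" "h \<le> 1" using \<delta> \<open>\<delta> \<le> 1/4\<close> by (simp_all add: h_def)
  have "2 * g \<le> 1" using g2 by simp
  have "0 < g" using h \<delta> by (simp add: g_def)
  have "0 < s" using \<epsilon> \<delta> by (simp add: s_def)
  have n: "1 / \<delta> \<le> n" "n \<le> 1 / \<delta> + 1" using \<delta> by (simp_all add: n_def)
  let ?V = "{..<n + 3}" and ?E = "theta_edges (n + 3)" and ?w = "theta_weight h g s"
  have graph: "weighted_graph ?V ?E ?w"
    using h \<open>0 < g\<close> \<open>0 < s\<close> by (intro weighted_graph_theta)
  have "1/5 * ((1/\<epsilon>) / x^2) * weight ?w G_opt \<le> weight ?w G_gr"
    if gr: "is_greedy_spanner (1 + x * \<epsilon>) ?E ?w G_gr"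
      and opt: "is_min_weight_spanner (1 + \<epsilon>) ?V ?E ?w G_opt" for G_gr G_opt
  proof -
    \<comment> \<open>Rounding up accounts for the summand \<open>1\<close>, and
      \<open>\<epsilon> \<le> \<delta>\<close> gives \<open>s \<le> 2 * \<delta>\<close>.\<close>
    have "n * s \<le> (1 / \<delta> + 1) * (2 * \<delta>)"
      using n \<delta> \<epsilon> by (intro mult_mono) (auto simp: s_def)
    also have "\<dots> \<le> 3" using \<delta> \<open>\<delta> \<le> 1/4\<close> by (simp add: field_simps)
    \<comment> \<open>Both \<open>h\<close> and \<open>2 * g\<close> are at most \<open>1\<close>.
      The reciprocal of this bound is the constant \<open>1/5\<close>.\<close>
    finally have "h + 2 * g + n * s \<le> 5" using h \<open>2 * g \<le> 1\<close> by simp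
    moreover have "weight ?w G_opt \<le> h + 2 * g + n * s"
    proof -
      have "is_spanner (1 + \<epsilon>) ?V ?E ?w (?E - (\<lambda>i. {0, i}) ` {3..<n + 3})"
        using \<epsilon> h \<open>0 < g\<close> \<open>0 < s\<close> by (intro light_spanner_theta) (auto simp: h_def s_def)
      then show ?thesis
        using opt unfolding is_min_weight_spanner_def weight_light_spanner_theta[symmetric] by blast
    qed
    ultimately have "weight ?w G_opt \<le> 5" by simp
    then have "1/5 * ((1/\<epsilon>) / x^2) * weight ?w G_opt \<le> 1/5 * ((1/\<epsilon>) / x^2) * 5"
      using \<epsilon> by (intro mult_left_mono) auto
    \<comment> \<open>A factor \<open>x \<ge> 1\<close> is given away: the left side is
      \<open>1 / (x^2 * \<epsilon>)\<close>, the right side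
      \<open>1 / (x * \<epsilon>)\<close>.\<close>
    also have "\<dots> \<le> 1 / \<delta>"
      using \<epsilon> x by (simp add: \<delta>_def field_simps power2_eq_square)
    also have "\<dots> \<le> n" by (fact n)
    also have "\<dots> = weight ?w ((\<lambda>i. {0, i}) ` {3..<n + 3})"
    proof -
      have "inj_on (\<lambda>i. {0, i}) {3..<n + 3}" by (auto simp: inj_on_def doubleton_eq_iff)
      then show ?thesis by (simp add: weight_def sum.reindex)
    qed
    also have "\<dots> \<le> weight ?w G_gr"
      unfolding weight_def
    proof (rule sum_mono2)
      have "G_gr \<subseteq> ?E" using gr by (rule greedy_spanner_subset)
      then show "finite G_gr"
        using weighted_graph_finite_edges[OF graph] by (rule finite_subset)
      show "0 \<le> ?w e" if "e \<in> G_gr - (\<lambda>i. {0, i}) ` {3..<n + 3}" for e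
        using that \<open>G_gr \<subseteq> ?E\<close> graph by (auto simp: weighted_graph_def less_imp_le)
      have "{0, i} \<in> G_gr" if "i \<in> {3..<n + 3}" for i
        using gr that
      proof (intro greedy_theta[where h = h and g = g and s = s and \<delta> = \<delta> and n = "n + 3"])
        \<comment> \<open>The two sides differ by \<open>\<epsilon> - \<delta>\<^sup>2\<close>,
          which is positive.\<close>
        show "1 + \<delta> < 2 * g + s" using \<delta>\<epsilon> \<epsilon> by (simp add: g2 s_def)
      qed (use h \<delta> \<open>\<delta> \<le> 1/4\<close> \<open>2 * g \<le> 1\<close> \<open>0 < s\<close> in \<open>simp_all add: g_def \<delta>_def\<close>)
      then show "(\<lambda>i. {0, i}) ` {3..<n + 3} \<subseteq> G_gr" by blast
    qed
    finally show ?thesis .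
  qed
  moreover have "planar ?V ?E" by (rule planar_theta) simp
  moreover have "?E \<noteq> {}" by (simp add: theta_edges_def)
  ultimately show "\<exists>(V :: nat set) (E :: nat set set) (w :: nat set \<Rightarrow> real).
      weighted_graph V E w \<and> planar V E \<and> E \<noteq> {} \<and>
      (\<forall>G_gr G_opt. is_greedy_spanner (1 + x * \<epsilon>) E w G_gr \<and>
         is_min_weight_spanner (1 + \<epsilon>) V E w G_opt \<longrightarrow>
         weight w G_gr \<ge> 1/5 * ((1/\<epsilon>) / x^2) * weight w G_opt)"
    using graph by blast
qed simp

end
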